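(* Let $n\ge 1$. For every fixed $p,q\in\triangle_n$ and every finite subset $\mathcal{M}\subset\mathcal{D}_n$, the set $$\{q^{\mathrm{T}}Mp : M\in\langle\mathcal{M}\rangle\}$$ is nowhere dense.
   Context: $\triangle_n=\{x\in[0,1]^n:|x|_1=1\}$ is the standard $(n-1)$-simplex (vectors are column vectors). $\mathcal{D}_n$ is the set of $n\times n$ doubly stochastic matrices: non-negative real matrices in which every row and every column sums to $1$; it is a semigroup under matrix multiplication. $\langle\mathcal{M}\rangle$ denotes the subsemigroup of $\mathcal{D}_n$ generated by $\mathcal{M}$ (all finite products of elements of $\mathcal{M}$), by convention also containing the identity matrix. "Nowhere dense" is meant as a subset of $\mathbb{R}$ (equivalently of $[0,1]$) with the standard topology: the closure has empty interior. *)

theory Defs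
  imports "HOL-Analysis.Analysis"
begin

definition std_simplex :: "(real ^ 'n) set" where
  "std_simplex = {x. (\<forall>i. x $ i \<in> {0..1}) \<and> (\<Sum>i\<in>UNIV. \<bar>x $ i\<bar>) = 1}"

definition doubly_stochastic :: "(real ^ 'n ^ 'n) set" where
  "doubly_stochastic = {A. (\<forall>i j. 0 \<le> A $ i $ j) \<and>
     (\<forall>i. (\<Sum>j\<in>UNIV. A $ i $ j) = 1) \<and> (\<forall>j. (\<Sum>i\<in>UNIV. A $ i $ j) = 1)}"

text \<open>By convention the generated semigroup always contains the identity matrix
  (the empty product).\<close>

inductive_set matrix_semigroup :: "(real ^ 'n ^ 'n) set \<Rightarrow> (real ^ 'n ^ 'n) set"
  for \<M> :: "(real ^ 'n ^ 'n) set" where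
  one: "mat 1 \<in> matrix_semigroup \<M>"
| incl: "A \<in> \<M> \<Longrightarrow> A \<in> matrix_semigroup \<M>"
| mult: "A \<in> matrix_semigroup \<M> \<Longrightarrow> B \<in> matrix_semigroup \<M> \<Longrightarrow> A ** B \<in> matrix_semigroup \<M>"

definition nowhere_dense :: "'a::topological_space set \<Rightarrow> bool" where
  "nowhere_dense S \<longleftrightarrow> interior (closure S) = {}"

end

theory Submission
  imports Defs
begin

text \<open>
  The closure of the semigroup is countable and compact, so its image under the continuous map
  \<open>M \<mapsto> q \<bullet> (M *v p)\<close> is a countable closed subset of the line.

  A doubly stochastic \<open>w\<close> is a Euclidean contraction. By the equality case of Jensen's inequality
  the vectors whose norm it preserves form a subspace, and this subspace together with the action
  of \<open>w\<close> on it depends only on the support of \<open>w\<close>, hence takes finitely many values. There is a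
  uniform \<open>c < 1\<close> such that every product \<open>w\<close> of generators contracts the orthogonal complement of
  its isometric part by \<open>c\<close>.

  Countability follows by induction on the codimension of the isometric part. A word whose isometric
  part has dimension \<open>d\<close> factors as \<open>u g\<^sub>s \<dots> g\<^sub>1\<close>, where each \<open>g\<^sub>i\<close> is a shortest block whose
  isometric part has dimension \<open>d\<close>, so that it is one generator times a word with larger isometric
  part. A limit of such words either has bounded \<open>s\<close>, and then lies in a finite product of
  compact sets known to be countable, or it vanishes on the orthogonal complement of the isometric
  part, which leaves finitely many matrices.
\<close>

section \<open>Isometric parts of doubly stochastic matrices\<close>

definition isometric_part :: "real ^ 'n ^ 'n \<Rightarrow> (real ^ 'n) set" where
  "isometric_part A = {x. norm (A *v x) = norm x}"

definition matrix_support :: "real ^ 'n ^ 'n \<Rightarrow> ('n \<times> 'n) set" where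
  "matrix_support A = {(i, j). A $ i $ j \<noteq> 0}"

lemma doubly_stochasticD:
  assumes "A \<in> doubly_stochastic"
  shows "0 \<le> A $ i $ j" "(\<Sum>j\<in>UNIV. A $ i $ j) = 1" "(\<Sum>i\<in>UNIV. A $ i $ j) = 1"
  using assms by (auto simp: doubly_stochastic_def)

lemma doubly_stochastic_mat_1: "mat 1 \<in> doubly_stochastic"
  by (auto simp: doubly_stochastic_def mat_def if_distrib cong: if_cong)

lemma doubly_stochastic_mult:
  assumes A: "A \<in> doubly_stochastic" and B: "B \<in> doubly_stochastic"
  shows "A ** B \<in> doubly_stochastic"
proof -
  have "(\<Sum>j\<in>UNIV. (A ** B) $ i $ j) = 1" for i
  proof -
    have "(\<Sum>j\<in>UNIV. (A ** B) $ i $ j) = (\<Sum>k\<in>UNIV. \<Sum>j\<in>UNIV. A $ i $ k * B $ k $ j)"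
      unfolding matrix_matrix_mult_def by (simp, rule sum.swap)
    also have "\<dots> = 1"
      by (simp add: sum_distrib_left[symmetric] doubly_stochasticD[OF A] doubly_stochasticD[OF B])
    finally show ?thesis .
  qed
  moreover have "(\<Sum>i\<in>UNIV. (A ** B) $ i $ j) = 1" for j
  proof -
    have "(\<Sum>i\<in>UNIV. (A ** B) $ i $ j) = (\<Sum>k\<in>UNIV. \<Sum>i\<in>UNIV. A $ i $ k * B $ k $ j)"
      unfolding matrix_matrix_mult_def by (simp, rule sum.swap)
    also have "\<dots> = 1"
      by (simp add: sum_distrib_right[symmetric] doubly_stochasticD[OF A] doubly_stochasticD[OF B])
    finally show ?thesis .
  qed
  moreover have "0 \<le> (A ** B) $ i $ j" for i j
    unfolding matrix_matrix_mult_def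
    by (simp add: sum_nonneg doubly_stochasticD[OF A] doubly_stochasticD[OF B])
  ultimately show ?thesis by (simp add: doubly_stochastic_def)
qed

text \<open>A variance identity: row \<open>i\<close> is a probability vector with mean
  \<open>(A *v x) $ i\<close>, so the inner sum is a variance, second moment minus squared mean.
  Column sums 1 make the second moments add up to the squared norm of \<open>x\<close>.\<close>

lemma doubly_stochastic_norm_loss:
  assumes A: "A \<in> doubly_stochastic"
  shows "(norm x)\<^sup>2 - (norm (A *v x))\<^sup>2 =
    (\<Sum>i\<in>UNIV. \<Sum>j\<in>UNIV. A $ i $ j * (x $ j - (A *v x) $ i)\<^sup>2)"
proof -
  let ?y = "A *v x"
  have y: "(\<Sum>j\<in>UNIV. A $ i $ j * x $ j) = ?y $ i" for i
    by (simp add: matrix_vector_mult_def)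
  have "(\<Sum>j\<in>UNIV. A $ i $ j * (x $ j - ?y $ i)\<^sup>2)
      = (\<Sum>j\<in>UNIV. A $ i $ j * (x $ j)\<^sup>2) - (?y $ i)\<^sup>2" for i
  proof -
    have "(\<Sum>j\<in>UNIV. A $ i $ j * (x $ j - ?y $ i)\<^sup>2)
      = (\<Sum>j\<in>UNIV. A $ i $ j * (x $ j)\<^sup>2 - 2 * ?y $ i * (A $ i $ j * x $ j) + (?y $ i)\<^sup>2 * A $ i $ j)"
      by (intro sum.cong refl) (simp add: power2_eq_square algebra_simps)
    also have "\<dots> = (\<Sum>j\<in>UNIV. A $ i $ j * (x $ j)\<^sup>2) - 2 * ?y $ i * ?y $ i + (?y $ i)\<^sup>2"
      by (simp add: sum.distrib sum_subtractf sum_distrib_left[symmetric] y doubly_stochasticD[OF A])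
    finally show ?thesis by (simp add: power2_eq_square)
  qed
  moreover have "(\<Sum>i\<in>UNIV. \<Sum>j\<in>UNIV. A $ i $ j * (x $ j)\<^sup>2) = (norm x)\<^sup>2"
  proof -
    have "(\<Sum>i\<in>UNIV. \<Sum>j\<in>UNIV. A $ i $ j * (x $ j)\<^sup>2) = (\<Sum>j\<in>UNIV. \<Sum>i\<in>UNIV. A $ i $ j * (x $ j)\<^sup>2)"
      by (rule sum.swap)
    also have "\<dots> = (\<Sum>j\<in>UNIV. (x $ j)\<^sup>2)"
      by (simp add: sum_distrib_right[symmetric] doubly_stochasticD[OF A])
    also have "\<dots> = (norm x)\<^sup>2"
      unfolding power2_norm_eq_inner inner_vec_def by (simp add: power2_eq_square)
    finally show ?thesis .
  qed
  moreover have "(norm ?y)\<^sup>2 = (\<Sum>i\<in>UNIV. (?y $ i)\<^sup>2)"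
    unfolding power2_norm_eq_inner inner_vec_def by (simp add: power2_eq_square)
  ultimately show ?thesis by (simp add: sum_subtractf)
qed

lemma doubly_stochastic_norm_le:
  assumes A: "A \<in> doubly_stochastic"
  shows "norm (A *v x) \<le> norm x"
proof -
  have "0 \<le> (norm x)\<^sup>2 - (norm (A *v x))\<^sup>2"
    unfolding doubly_stochastic_norm_loss[OF A]
    by (intro sum_nonneg mult_nonneg_nonneg doubly_stochasticD(1)[OF A]) simp
  then show ?thesis by (simp add: abs_le_square_iff[symmetric])
qed

text \<open>A sum of nonnegative terms vanishes only termwise, so \<open>x $ j\<close> must equal
  \<open>(A *v x) $ i\<close> wherever \<open>A $ i $ j\<close> is nonzero. Keeping the entry as a
  factor makes the condition linear in \<open>x\<close>.\<close>

lemma isometric_part_iff: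
  assumes A: "A \<in> doubly_stochastic"
  shows "x \<in> isometric_part A \<longleftrightarrow> (\<forall>i j. A $ i $ j * x $ j = A $ i $ j * (A *v x) $ i)"
proof -
  have nn: "0 \<le> A $ i $ j * (x $ j - (A *v x) $ i)\<^sup>2" for i j
    by (intro mult_nonneg_nonneg doubly_stochasticD(1)[OF A]) simp
  have "x \<in> isometric_part A \<longleftrightarrow> (norm x)\<^sup>2 - (norm (A *v x))\<^sup>2 = 0"
    by (auto simp: isometric_part_def)
  also have "\<dots> \<longleftrightarrow> (\<forall>i j. A $ i $ j * (x $ j - (A *v x) $ i)\<^sup>2 = 0)"
    unfolding doubly_stochastic_norm_loss[OF A]
    by (simp add: sum_nonneg_eq_0_iff sum_nonneg nn)
  also have "\<dots> \<longleftrightarrow> (\<forall>i j. A $ i $ j * x $ j = A $ i $ j * (A *v x) $ i)"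
    by auto
  finally show ?thesis .
qed

lemma subspace_isometric_part:
  assumes A: "A \<in> doubly_stochastic"
  shows "subspace (isometric_part A)"
proof (rule subspaceI)
  show "0 \<in> isometric_part A" by (simp add: isometric_part_def)
next
  fix x y assume "x \<in> isometric_part A" "y \<in> isometric_part A"
  then show "x + y \<in> isometric_part A"
    unfolding isometric_part_iff[OF A]
    by (simp only: matrix_vector_right_distrib vector_add_component distrib_left) simp
next
  fix r x assume "x \<in> isometric_part A"
  then show "r *\<^sub>R x \<in> isometric_part A"
    by (simp add: isometric_part_def matrix_vector_mult_scaleR)
qed

text \<open>Row \<open>i\<close> of \<open>A\<close> averages equal numbers: every
  \<open>x $ j\<close> that it sees is \<open>(A *v x) $ i\<close>. Other weights on the same
  support give the same average.\<close>

lemma isometric_part_support_cong: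
  assumes A: "A \<in> doubly_stochastic" and B: "B \<in> doubly_stochastic"
    and supp: "matrix_support A = matrix_support B" and x: "x \<in> isometric_part A"
  shows "B *v x = A *v x" "x \<in> isometric_part B"
proof -
  have *: "B $ i $ j * x $ j = B $ i $ j * (A *v x) $ i" for i j
  proof (cases "B $ i $ j = 0")
    case False
    then have "A $ i $ j \<noteq> 0" using supp by (auto simp: matrix_support_def)
    then show ?thesis using x by (auto simp: isometric_part_iff[OF A])
  qed simp
  have "(B *v x) $ i = (A *v x) $ i" for i
  proof -
    have "(B *v x) $ i = (\<Sum>j\<in>UNIV. B $ i $ j * (A *v x) $ i)"
      unfolding matrix_vector_mult_def[of B] by (simp add: *)
    then show ?thesis by (simp add: sum_distrib_right[symmetric] doubly_stochasticD[OF B])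
  qed
  then show "B *v x = A *v x" by (simp add: vec_eq_iff)
  then show "x \<in> isometric_part B" using x by (simp add: isometric_part_def)
qed

text \<open>Only one of the two vectors has to be isometric, because the equality condition makes
  \<open>transpose A ** A\<close> fix \<open>y\<close>. Hence vectors orthogonal to \<open>y\<close>
  are sent to vectors orthogonal to its image, which is how complements are followed through
  products.\<close>

lemma inner_isometric_part:
  assumes A: "A \<in> doubly_stochastic" and y: "y \<in> isometric_part A"
  shows "(A *v x) \<bullet> (A *v y) = x \<bullet> y"
proof -
  have *: "A $ i $ j * (A *v y) $ i = A $ i $ j * y $ j" for i j
    using y unfolding isometric_part_iff[OF A] by metis
  have "(A *v x) \<bullet> (A *v y) = (\<Sum>i\<in>UNIV. \<Sum>j\<in>UNIV. x $ j * (A $ i $ j * (A *v y) $ i))"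
    unfolding inner_vec_def matrix_vector_mult_def[of A x]
    by (simp add: sum_distrib_left mult_ac)
  also have "\<dots> = (\<Sum>j\<in>UNIV. \<Sum>i\<in>UNIV. A $ i $ j * (x $ j * y $ j))"
    unfolding * by (subst sum.swap) (simp add: mult_ac)
  also have "\<dots> = x \<bullet> y"
    by (simp add: sum_distrib_right[symmetric] doubly_stochasticD[OF A] inner_vec_def)
  finally show ?thesis .
qed

lemma isometric_part_mult:
  assumes A: "A \<in> doubly_stochastic" and B: "B \<in> doubly_stochastic"
  shows "x \<in> isometric_part (A ** B) \<longleftrightarrow> x \<in> isometric_part B \<and> B *v x \<in> isometric_part A"
  using doubly_stochastic_norm_le[OF A, of "B *v x"] doubly_stochastic_norm_le[OF B, of x]
  by (auto simp: isometric_part_def matrix_vector_mul_assoc[symmetric])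

lemma dim_image_isometric_part:
  assumes A: "A \<in> doubly_stochastic"
  shows "dim ((*v) A ` isometric_part A) = dim (isometric_part A)"
proof (rule dim_image_eq)
  show "linear ((*v) A)" by simp
  show "inj_on ((*v) A) (span (isometric_part A))"
  proof (rule inj_onI)
    fix x y assume "x \<in> span (isometric_part A)" "y \<in> span (isometric_part A)" "A *v x = A *v y"
    then have "x - y \<in> isometric_part A" "A *v (x - y) = 0"
      using subspace_isometric_part[OF A]
      by (auto simp: span_eq_iff[THEN iffD2] subspace_diff matrix_vector_mult_diff_distrib)
    then show "x = y" by (simp add: isometric_part_def)
  qed
qed

text \<open>Compactness of the unit sphere of \<open>Y\<close> turns the strict inequality into a
  factor below 1, the maximum of the norm of \<open>A *v y\<close> over that sphere.\<close>

lemma contraction_factor_on_subspace: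
  fixes A :: "real ^ 'n ^ 'n"
  assumes Y: "subspace Y" and less: "\<And>y. y \<in> Y \<Longrightarrow> y \<noteq> 0 \<Longrightarrow> norm (A *v y) < norm y"
  shows "\<exists>c. 0 \<le> c \<and> c < 1 \<and> (\<forall>y\<in>Y. norm (A *v y) \<le> c * norm y)"
proof (cases "Y \<inter> sphere 0 1 = {}")
  case True
  have "y = 0" if "y \<in> Y" for y
  proof (rule ccontr)
    assume "y \<noteq> 0"
    then have "(1 / norm y) *\<^sub>R y \<in> Y \<inter> sphere 0 1"
      using that Y by (simp add: subspace_scale)
    with True show False by blast
  qed
  then show ?thesis by (intro exI[of _ 0]) (metis less_numeral_extra(1)
    matrix_vector_mult_0_right mult_zero_left norm_zero order_refl)
next
  case False
  have "compact (Y \<inter> sphere 0 1)"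
    by (simp add: Y closed_Int_compact closed_subspace)
  moreover have "continuous_on (Y \<inter> sphere 0 1) (\<lambda>y. norm (A *v y))"
    by (intro continuous_intros)
  ultimately obtain y0 where y0: "y0 \<in> Y \<inter> sphere 0 1"
    and max: "\<And>y. y \<in> Y \<inter> sphere 0 1 \<Longrightarrow> norm (A *v y) \<le> norm (A *v y0)"
    using continuous_attains_sup[OF _ False] by blast
  have "norm (A *v y) \<le> norm (A *v y0) * norm y" if "y \<in> Y" for y
  proof (cases "y = 0")
    case False
    then have "(1 / norm y) *\<^sub>R y \<in> Y \<inter> sphere 0 1"
      using that Y by (simp add: subspace_scale)
    from max[OF this] False show ?thesis
      by (simp add: matrix_vector_mult_scaleR field_simps)
  qed simp
  moreover have "norm (A *v y0) < 1" using y0 less[of y0] by fastforce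
  ultimately show ?thesis by (intro exI[of _ "norm (A *v y0)"]) auto
qed

section \<open>Words in the generators\<close>

definition word_product :: "(real ^ 'n ^ 'n) list \<Rightarrow> real ^ 'n ^ 'n" where
  "word_product xs = foldr (**) xs (mat 1)"

lemma word_product_simps [simp]:
  "word_product [] = mat 1" "word_product (a # xs) = a ** word_product xs"
  by (simp_all add: word_product_def)

lemma word_product_append: "word_product (xs @ ys) = word_product xs ** word_product ys"
  by (induction xs) (simp_all add: matrix_mul_assoc)

lemma matrix_semigroup_eq_word_products: "matrix_semigroup \<M> = word_product ` lists \<M>"
proof
  show "matrix_semigroup \<M> \<subseteq> word_product ` lists \<M>"
  proof
    fix w assume "w \<in> matrix_semigroup \<M>"
    then show "w \<in> word_product ` lists \<M>"
    proof induction
      case one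
      show ?case by (rule image_eqI[of _ _ "[]"]) auto
    next
      case (incl A)
      then show ?case by (intro image_eqI[of _ _ "[A]"]) auto
    next
      case (mult A B)
      then obtain xs ys where "xs \<in> lists \<M>" "ys \<in> lists \<M>" "A = word_product xs" "B = word_product ys"
        by blast
      then show ?case by (intro image_eqI[of _ _ "xs @ ys"]) (auto simp: word_product_append)
    qed
  qed
next
  have "word_product xs \<in> matrix_semigroup \<M>" if "xs \<in> lists \<M>" for xs
    using that by induction (auto intro: matrix_semigroup.intros)
  then show "word_product ` lists \<M> \<subseteq> matrix_semigroup \<M>" by blast
qed

lemma word_product_in_doubly_stochastic:
  assumes "\<M> \<subseteq> doubly_stochastic" "xs \<in> lists \<M>"
  shows "word_product xs \<in> doubly_stochastic"
  using assms(2) by induction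
    (use assms(1) in \<open>auto simp: doubly_stochastic_mat_1 intro: doubly_stochastic_mult\<close>)

lemma dim_isometric_part_mat_1: "dim (isometric_part (mat 1 :: real ^ 'n ^ 'n)) = CARD('n)"
  by (simp add: isometric_part_def)

text \<open>The list head is the leftmost factor, so suffixes act first. The empty suffix has full
  dimension, above \<open>d\<close>, and the whole word has dimension at most \<open>d\<close>; some
  letter \<open>b\<close> must cross the threshold.\<close>

lemma word_split_at_drop:
  fixes xs :: "(real ^ 'n ^ 'n) list"
  assumes "dim (isometric_part (word_product xs)) \<le> d" "d < CARD('n)"
  shows "\<exists>ys b zs. xs = ys @ b # zs \<and> d < dim (isometric_part (word_product zs))
    \<and> dim (isometric_part (word_product (b # zs))) \<le> d"
  using assms(1)
proof (induction xs)
  case Nil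
  then show ?case using assms(2) by (simp add: dim_isometric_part_mat_1)
next
  case (Cons a xs)
  show ?case
  proof (cases "dim (isometric_part (word_product xs)) \<le> d")
    case True
    then obtain ys b zs where "xs = ys @ b # zs" "d < dim (isometric_part (word_product zs))"
      "dim (isometric_part (word_product (b # zs))) \<le> d" using Cons.IH by blast
    then show ?thesis by (intro exI[of _ "a # ys"] exI[of _ b] exI[of _ zs]) simp
  next
    case False
    then show ?thesis using Cons.prems by (intro exI[of _ "[]"] exI[of _ a] exI[of _ xs]) simp
  qed
qed

section \<open>A uniform contraction constant for all words\<close>

lemma uniform_constant_below_1:
  fixes Q :: "'a \<Rightarrow> real \<Rightarrow> bool"
  assumes "finite I" and mono: "\<And>i c c'. Q i c \<Longrightarrow> c \<le> c' \<Longrightarrow> Q i c'"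
    and "\<And>i. i \<in> I \<Longrightarrow> \<exists>c. 0 \<le> c \<and> c < 1 \<and> Q i c"
  shows "\<exists>c. 0 \<le> c \<and> c < 1 \<and> (\<forall>i\<in>I. Q i c)"
  using assms(1,3)
proof (induction I rule: finite_induct)
  case empty
  show ?case by (rule exI[of _ 0]) simp
next
  case (insert i I)
  then obtain c c' where c: "0 \<le> c" "c < 1" "\<forall>i\<in>I. Q i c" "0 \<le> c'" "c' < 1" "Q i c'"
    by (meson insertCI)
  then have "\<forall>j\<in>insert i I. Q j (max c c')"
    using mono[of _ c "max c c'"] mono[of _ c' "max c c'"] by auto
  then show ?case using c by (intro exI[of _ "max c c'"]) auto
qed

text \<open>Infinitely many \<open>u\<close> fall into finitely many cases:
  \<open>isometric_part u\<close> and the action of \<open>u\<close> on it depend on the support of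
  \<open>u\<close>, the isometric part of \<open>b ** u\<close> on the support of
  \<open>b ** u\<close>, and \<open>b\<close> lies in a finite set. Each triple gets a constant by
  compactness, and one constant below 1 dominates them all.\<close>

lemma one_letter_gap:
  fixes \<M> :: "(real ^ 'n ^ 'n) set"
  assumes fin: "finite \<M>" and ds: "\<M> \<subseteq> doubly_stochastic"
  shows "\<exists>c. 0 \<le> c \<and> c < 1 \<and> (\<forall>b\<in>\<M>. \<forall>u\<in>doubly_stochastic. \<forall>y\<in>isometric_part u.
    (\<forall>z\<in>isometric_part (b ** u). orthogonal y z) \<longrightarrow> norm ((b ** u) *v y) \<le> c * norm y)"
proof -
  define Q where "Q i c \<longleftrightarrow> (\<forall>u\<in>doubly_stochastic. matrix_support u = fst i \<longrightarrow>
      matrix_support (snd (snd i) ** u) = fst (snd i) \<longrightarrow>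
      (\<forall>y\<in>isometric_part u. (\<forall>z\<in>isometric_part (snd (snd i) ** u). orthogonal y z) \<longrightarrow>
        norm ((snd (snd i) ** u) *v y) \<le> c * norm y))"
    for i :: "('n \<times> 'n) set \<times> ('n \<times> 'n) set \<times> (real ^ 'n ^ 'n)" and c :: real
  let ?I = "UNIV \<times> UNIV \<times> \<M> :: (('n \<times> 'n) set \<times> ('n \<times> 'n) set \<times> (real ^ 'n ^ 'n)) set"
  have "\<exists>c. 0 \<le> c \<and> c < 1 \<and> (\<forall>i\<in>?I. Q i c)"
  proof (rule uniform_constant_below_1)
    show "finite ?I" using fin by simp
  next
    fix i c c' assume Q: "Q i c" and "c \<le> c'"
    then have "c * norm y \<le> c' * norm y" for y :: "real ^ 'n" by (simp add: mult_right_mono)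
    with Q show "Q i c'" unfolding Q_def by (blast intro: order_trans)
  next
    fix i assume i_in: "i \<in> ?I"
    obtain \<sigma> \<tau> b where i: "i = (\<sigma>, \<tau>, b)" and b: "b \<in> doubly_stochastic"
      using i_in ds by (cases i) auto
    show "\<exists>c. 0 \<le> c \<and> c < 1 \<and> Q i c"
    proof (cases "\<exists>u\<in>doubly_stochastic. matrix_support u = \<sigma> \<and> matrix_support (b ** u) = \<tau>")
      case False
      then have "Q i 0" unfolding i Q_def by simp
      then show ?thesis by (intro exI[of _ 0]) simp
    next
      case True
      \<comment> \<open>One representative \<open>v\<close> decides the constant for all
        \<open>u\<close> with the same two supports.\<close>
      then obtain v where v: "v \<in> doubly_stochastic" "matrix_support v = \<sigma>" "matrix_support (b ** v) = \<tau>"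
        by blast
      let ?Y = "isometric_part v \<inter> {y. \<forall>z\<in>isometric_part (b ** v). orthogonal z y}"
      have "subspace ?Y"
        by (intro subspace_inter subspace_isometric_part v subspace_orthogonal_to_vectors)
      moreover have "norm ((b ** v) *v y) < norm y" if y: "y \<in> ?Y" "y \<noteq> 0" for y
      proof -
        have "y \<notin> isometric_part (b ** v)" using y by (auto simp: orthogonal_self)
        then show ?thesis
          using doubly_stochastic_norm_le[OF doubly_stochastic_mult[OF b v(1)], of y]
          by (auto simp: isometric_part_def)
      qed
      ultimately obtain c where c: "0 \<le> c" "c < 1" "\<forall>y\<in>?Y. norm ((b ** v) *v y) \<le> c * norm y"
        using contraction_factor_on_subspace by blast
      have "norm ((b ** u) *v y) \<le> c * norm y"
        if u: "u \<in> doubly_stochastic" "matrix_support u = \<sigma>" "matrix_support (b ** u) = \<tau>"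
          and y: "y \<in> isometric_part u" "\<forall>z\<in>isometric_part (b ** u). orthogonal y z" for u y
      proof -
        have uv: "v *v y = u *v y" "y \<in> isometric_part v"
          using isometric_part_support_cong[OF u(1) v(1) _ y(1)] u(2) v(2) by simp_all
        \<comment> \<open>This inclusion transfers the orthogonality of \<open>y\<close> from
          \<open>b ** u\<close> to \<open>b ** v\<close>.\<close>
        moreover have "isometric_part (b ** v) \<subseteq> isometric_part (b ** u)"
          using isometric_part_support_cong(2)[OF doubly_stochastic_mult[OF b v(1)]
            doubly_stochastic_mult[OF b u(1)]] u(3) v(3) by blast
        ultimately have "y \<in> ?Y" using y(2) orthogonal_commute by blast
        then have "norm ((b ** v) *v y) \<le> c * norm y" using c by blast
        then show ?thesis by (simp add: matrix_vector_mul_assoc[symmetric] uv)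
      qed
      then have "Q i c" unfolding i Q_def fst_conv snd_conv by blast
      then show ?thesis using c(1,2) by blast
    qed
  qed
  then obtain c where c: "0 \<le> c" "c < 1" and Q: "\<And>i. i \<in> ?I \<Longrightarrow> Q i c" by blast
  have "norm ((b ** u) *v y) \<le> c * norm y"
    if "b \<in> \<M>" and "u \<in> doubly_stochastic" and "y \<in> isometric_part u"
      and "\<forall>z\<in>isometric_part (b ** u). orthogonal y z" for b u y
    using Q[of "(matrix_support u, matrix_support (b ** u), b)"] that by (simp add: Q_def)
  then show ?thesis using c by blast
qed

text \<open>Induction on \<open>k\<close> over words of codimension less than \<open>k\<close>,
  written additively to avoid truncated subtraction. A word reaches its final dimension at one
  letter \<open>b\<close>; the suffix to the right of \<open>b\<close> has smaller codimension and
  contracts by induction, while \<open>one_letter_gap\<close> controls the effect of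
  \<open>b\<close>.\<close>

lemma semigroup_gap_aux:
  fixes \<M> :: "(real ^ 'n ^ 'n) set"
  assumes fin: "finite \<M>" and ds: "\<M> \<subseteq> doubly_stochastic"
  shows "\<exists>c. 0 \<le> c \<and> c < 1 \<and> (\<forall>xs\<in>lists \<M>.
    CARD('n) < dim (isometric_part (word_product xs)) + k \<longrightarrow>
    (\<forall>x. (\<forall>z\<in>isometric_part (word_product xs). orthogonal x z) \<longrightarrow>
      norm (word_product xs *v x) \<le> c * norm x))"
proof (induction k)
  case 0
  have "\<not> CARD('n) < dim (isometric_part (word_product xs))" for xs :: "(real ^ 'n ^ 'n) list"
    using dim_subset_UNIV_cart[of "isometric_part (word_product xs)"] by simp
  then show ?case by (auto intro!: exI[of _ 0])
next
  case (Suc k)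
  then obtain c where c: "0 \<le> c" "c < 1"
    and IH: "\<And>xs x. xs \<in> lists \<M> \<Longrightarrow> CARD('n) < dim (isometric_part (word_product xs)) + k \<Longrightarrow>
      (\<forall>z\<in>isometric_part (word_product xs). orthogonal x z) \<Longrightarrow> norm (word_product xs *v x) \<le> c * norm x"
    by blast
  obtain c' where c': "0 \<le> c'" "c' < 1"
    and gap: "\<And>b u y. b \<in> \<M> \<Longrightarrow> u \<in> doubly_stochastic \<Longrightarrow> y \<in> isometric_part u \<Longrightarrow>
      (\<forall>z\<in>isometric_part (b ** u). orthogonal y z) \<Longrightarrow> norm ((b ** u) *v y) \<le> c' * norm y"
    using one_letter_gap[OF fin ds] by metis
  \<comment> \<open>Split \<open>x = y + z\<close> along the isometric part of \<open>u\<close>: if \<open>z\<close> is small (at most \<open>t\<close> times \<open>x\<close>)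
    the last letter contracts \<open>y\<close> by \<open>c'\<close>, otherwise \<open>u\<close> already contracts \<open>z\<close> by \<open>c\<close>.\<close>
  define t where "t = (1 - c') / 2"
  have t: "0 < t" "t \<le> 1" "c' + t < 1" using c' by (auto simp: t_def field_simps)
  \<comment> \<open>For large \<open>z\<close> the map \<open>u\<close> lowers the squared norm of
    \<open>x\<close> by at least \<open>(1 - c\<^sup>2) * t\<^sup>2\<close> times itself;
    \<open>e\<close> is the resulting factor.\<close>
  define e where "e = sqrt (1 - (1 - c\<^sup>2) * t\<^sup>2)"
  have c2: "c\<^sup>2 < 1" "0 \<le> c\<^sup>2" using c by (auto simp: power_less_one_iff abs_square_less_1)
  have t2: "0 < t\<^sup>2" "t\<^sup>2 \<le> 1" using t by (auto simp: power_le_one)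
  have e2: "0 < (1 - c\<^sup>2) * t\<^sup>2" "(1 - c\<^sup>2) * t\<^sup>2 \<le> 1"
    using c2 t2 mult_mono[of "1 - c\<^sup>2" 1 "t\<^sup>2" 1] by auto
  have e: "0 \<le> e" "e < 1" "e\<^sup>2 = 1 - (1 - c\<^sup>2) * t\<^sup>2"
    using e2 by (auto simp: e_def)
  define m where "m = max c (max (c' + t) e)"
  have m: "0 \<le> m" "m < 1" "c \<le> m" "c' + t \<le> m" "e \<le> m" using c e t by (auto simp: m_def)
  have "norm (word_product xs *v x) \<le> m * norm x"
    if xs: "xs \<in> lists \<M>" and d: "CARD('n) < dim (isometric_part (word_product xs)) + Suc k"
      and x: "\<forall>z\<in>isometric_part (word_product xs). orthogonal x z" for xs x
  proof (cases "CARD('n) < dim (isometric_part (word_product xs)) + k")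
    case True
    have "norm (word_product xs *v x) \<le> c * norm x" by (rule IH[OF xs True x])
    also have "\<dots> \<le> m * norm x" using m by (intro mult_right_mono) auto
    finally show ?thesis .
  next
    case False
    let ?d = "dim (isometric_part (word_product xs))"
    show ?thesis
    \<comment> \<open>Splitting the word needs a dimension below the full one. A full isometric part
      is settled first: only 0 is orthogonal to it.\<close>
    proof (cases "k = 0")
      case True
      then have "?d = CARD('n)" using d dim_subset_UNIV_cart[of "isometric_part (word_product xs)"] by simp
      then have "span (isometric_part (word_product xs)) = UNIV"
        by (metis dim_eq_full DIM_cart DIM_real mult.right_neutral)
      then have "x \<in> isometric_part (word_product xs)"
        using subspace_isometric_part[OF word_product_in_doubly_stochastic[OF ds xs]]
        by (simp add: span_eq_iff[THEN iffD2])
      then have "x = 0" using x by (auto simp: orthogonal_self)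
      then show ?thesis by simp
    next
      case k: False
      then have "?d < CARD('n)" using False by simp
      then obtain ys b zs where split: "xs = ys @ b # zs"
        and dz: "?d < dim (isometric_part (word_product zs))"
        and dbz: "dim (isometric_part (word_product (b # zs))) \<le> ?d"
        using word_split_at_drop[of xs ?d] by blast
      have mem: "ys \<in> lists \<M>" "b \<in> \<M>" "zs \<in> lists \<M>" using xs split by auto
      define v where "v = word_product ys"
      define u where "u = word_product zs"
      have dsv: "v \<in> doubly_stochastic" and dsu: "u \<in> doubly_stochastic" and dsb: "b \<in> doubly_stochastic"
        using word_product_in_doubly_stochastic[OF ds] mem ds by (auto simp: v_def u_def)
      have dsg: "b ** u \<in> doubly_stochastic" by (rule doubly_stochastic_mult[OF dsb dsu])
      have w: "word_product xs = v ** (b ** u)" by (simp add: split word_product_append v_def u_def)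
      have sub: "isometric_part (word_product xs) \<subseteq> isometric_part (b ** u)"
        using isometric_part_mult[OF dsv dsg] w by auto
      have eq: "isometric_part (word_product xs) = isometric_part (b ** u)"
        by (rule subspace_dim_equal[OF _ _ sub])
          (use dbz in \<open>auto simp: u_def intro!: subspace_isometric_part dsg[unfolded u_def]
            word_product_in_doubly_stochastic[OF ds xs]\<close>)
      obtain y z where y: "y \<in> span (isometric_part u)"
        and z: "\<And>a. a \<in> span (isometric_part u) \<Longrightarrow> orthogonal z a" and xyz: "x = y + z"
        using orthogonal_subspace_decomp_exists by blast
      have y': "y \<in> isometric_part u"
        using y subspace_isometric_part[OF dsu] by (simp add: span_eq_iff[THEN iffD2])
      have z': "\<forall>a\<in>isometric_part u. orthogonal z a" using z span_base by blast
      have yz: "orthogonal y z" using z[OF y] by (simp add: orthogonal_commute)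
      \<comment> \<open>\<open>y = x - z\<close>, and both terms are orthogonal to the isometric
        part of \<open>b ** u\<close>, which lies inside that of \<open>u\<close>.\<close>
      have yorth: "\<forall>a\<in>isometric_part (b ** u). orthogonal y a"
      proof
        fix a assume a: "a \<in> isometric_part (b ** u)"
        then have "a \<in> isometric_part u" using isometric_part_mult[OF dsb dsu] by auto
        then have "orthogonal z a" "orthogonal x a" using z' x eq a by auto
        then show "orthogonal y a" by (simp add: xyz orthogonal_def inner_add_left)
      qed
      have wx: "norm (word_product xs *v x) \<le> norm ((b ** u) *v x)"
        unfolding w by (simp add: matrix_vector_mul_assoc[symmetric] doubly_stochastic_norm_le[OF dsv])
      have x2: "(norm x)\<^sup>2 = (norm y)\<^sup>2 + (norm z)\<^sup>2"
        unfolding xyz by (rule norm_add_Pythagorean[OF yz])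
      have yx: "norm y \<le> norm x"
        by (rule power2_le_imp_le) (use x2 in auto)
      show ?thesis
      proof (cases "norm z \<le> t * norm x")
        case True
        have "norm ((b ** u) *v x) \<le> norm ((b ** u) *v y) + norm ((b ** u) *v z)"
          unfolding xyz by (simp add: matrix_vector_right_distrib norm_triangle_ineq)
        also have "\<dots> \<le> c' * norm y + norm z"
          by (intro add_mono gap mem dsu y' yorth doubly_stochastic_norm_le dsg)
        also have "\<dots> \<le> c' * norm x + t * norm x"
          by (intro add_mono True mult_left_mono yx c')
        also have "\<dots> = (c' + t) * norm x" by (simp add: algebra_simps)
        also have "\<dots> \<le> m * norm x" using m by (intro mult_right_mono) auto
        finally show ?thesis using wx by simp
      next
        case False
        \<comment> \<open>Since \<open>y\<close> is isometric for \<open>u\<close>, its image stays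
          orthogonal to that of \<open>z\<close>, and Pythagoras applies again after
          \<open>u\<close>.\<close>
        have "orthogonal (u *v y) (u *v z)"
          using inner_isometric_part[OF dsu y', of z] yz
          by (simp add: orthogonal_def inner_commute)
        then have "(norm (u *v x))\<^sup>2 = (norm (u *v y))\<^sup>2 + (norm (u *v z))\<^sup>2"
          unfolding xyz by (simp add: matrix_vector_right_distrib norm_add_Pythagorean)
        moreover have "norm (u *v y) = norm y" using y' by (simp add: isometric_part_def)
        moreover have "norm (u *v z) \<le> c * norm z"
          unfolding u_def by (rule IH) (use mem dz d z' in \<open>auto simp: u_def\<close>)
        ultimately have "(norm (u *v x))\<^sup>2 \<le> (norm y)\<^sup>2 + (c * norm z)\<^sup>2" by (simp add: power_mono)
        also have "\<dots> = (norm x)\<^sup>2 - (1 - c\<^sup>2) * (norm z)\<^sup>2"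
          by (simp add: x2 power_mult_distrib algebra_simps)
        also have "\<dots> \<le> (norm x)\<^sup>2 - (1 - c\<^sup>2) * (t * norm x)\<^sup>2"
          using False t c2 by (intro diff_left_mono mult_left_mono power_mono) auto
        also have "\<dots> = (e * norm x)\<^sup>2"
          by (simp add: power_mult_distrib e(3) algebra_simps)
        finally have "norm (u *v x) \<le> e * norm x"
          by (rule power2_le_imp_le) (simp add: e)
        also have "\<dots> \<le> m * norm x" using m by (intro mult_right_mono) auto
        finally show ?thesis
          using wx doubly_stochastic_norm_le[OF dsb, of "u *v x"]
          by (simp add: matrix_vector_mul_assoc[symmetric])
      qed
    qed
  qed
  then show ?case using m by blast
qed

text \<open>Taking \<open>k\<close> to be \<open>Suc CARD('n)\<close> makes the codimension bound
  hold for every word, so one constant serves the whole semigroup.\<close>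

lemma semigroup_gap:
  fixes \<M> :: "(real ^ 'n ^ 'n) set"
  assumes "finite \<M>" "\<M> \<subseteq> doubly_stochastic"
  obtains c where "0 \<le> c" "c < 1"
    "\<And>xs x. xs \<in> lists \<M> \<Longrightarrow> (\<And>z. z \<in> isometric_part (word_product xs) \<Longrightarrow> orthogonal x z) \<Longrightarrow>
      norm (word_product xs *v x) \<le> c * norm x"
proof -
  obtain c where c: "0 \<le> c" "c < 1" and gap: "\<forall>xs\<in>lists \<M>.
    CARD('n) < dim (isometric_part (word_product xs)) + Suc CARD('n) \<longrightarrow>
    (\<forall>x. (\<forall>z\<in>isometric_part (word_product xs). orthogonal x z) \<longrightarrow>
      norm (word_product xs *v x) \<le> c * norm x)"
    using semigroup_gap_aux[OF assms, of "Suc CARD('n)"] by blast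
  show thesis
  proof (rule that[OF c])
    fix xs x assume "xs \<in> lists \<M>"
      and "\<And>z. z \<in> isometric_part (word_product xs) \<Longrightarrow> orthogonal x z"
    then show "norm (word_product xs *v x) \<le> c * norm x"
      using gap by simp
  qed
qed

section \<open>Compactness and limits of contracted words\<close>

lemma bounded_doubly_stochastic: "bounded (doubly_stochastic :: (real ^ 'n ^ 'n) set)"
proof (rule boundedI)
  fix A :: "real ^ 'n ^ 'n" assume A: "A \<in> doubly_stochastic"
  have row: "norm (A $ i) \<le> 1" for i
  proof -
    have "norm (A $ i) \<le> (\<Sum>j\<in>UNIV. \<bar>A $ i $ j\<bar>)" by (rule norm_le_l1_cart)
    then show ?thesis by (simp add: doubly_stochasticD[OF A])
  qed
  have "norm A \<le> (\<Sum>i\<in>UNIV. norm (A $ i))"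
    unfolding norm_vec_def by (intro L2_set_le_sum) simp
  also have "\<dots> \<le> of_nat CARD('n) * 1" by (intro sum_bounded_above row)
  finally show "norm A \<le> of_nat CARD('n)" by simp
qed

lemma continuous_on_matrix_mult [continuous_intros]:
  fixes f g :: "'a::topological_space \<Rightarrow> real ^ 'n ^ 'n"
  assumes "continuous_on S f" "continuous_on S g"
  shows "continuous_on S (\<lambda>x. f x ** g x)"
  unfolding matrix_matrix_mult_def
  by (intro continuous_on_vec_lambda continuous_on_sum continuous_on_mult continuous_on_component assms)

lemma continuous_on_matrix_vector_left [continuous_intros]:
  fixes f :: "'a::topological_space \<Rightarrow> real ^ 'n ^ 'n"
  assumes "continuous_on S f"
  shows "continuous_on S (\<lambda>x. f x *v v)"
  unfolding matrix_vector_mult_def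
  by (intro continuous_on_vec_lambda continuous_on_sum continuous_on_mult continuous_on_component
      continuous_on_const assms)

text \<open>The limit is determined on two complementary spaces. On the isometric part of any
  \<open>v\<close> in the class all members act like \<open>v\<close>, a closed condition. On its
  orthogonal complement the bound with \<open>c ^ N\<close> survives in the closure for every
  \<open>N\<close>, so the limit is 0 there.\<close>

lemma contracted_words_limit_unique:
  fixes c :: real and \<sigma> :: "('n::finite \<times> 'n) set"
  defines "G \<equiv> \<lambda>N. {w \<in> doubly_stochastic. matrix_support w = \<sigma> \<and>
    (\<forall>x. (\<forall>z\<in>isometric_part w. orthogonal x z) \<longrightarrow> norm (w *v x) \<le> c ^ N * norm x)}"
  assumes c: "0 \<le> c" "c < 1" and A: "\<And>N. A \<in> closure (G N)" and B: "\<And>N. B \<in> closure (G N)"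
  shows "A = B"
proof -
  have "G 0 \<noteq> {}" using A[of 0] by auto
  then obtain v where v: "v \<in> doubly_stochastic" "matrix_support v = \<sigma>" by (auto simp: G_def)
  have on_iso: "W *v y = v *v y" if W: "\<And>N. W \<in> closure (G N)" and y: "y \<in> isometric_part v" for W y
  proof -
    have "G 0 \<subseteq> {W. W *v y = v *v y}"
    proof
      fix w assume "w \<in> G 0"
      then show "w \<in> {W. W *v y = v *v y}"
        using isometric_part_support_cong(1)[of v w y] v y by (simp add: G_def)
    qed
    moreover have "closed {W. W *v y = v *v y}"
      by (intro closed_Collect_eq continuous_intros)
    ultimately show ?thesis using W[of 0] closure_minimal by blast
  qed
  have on_orth: "W *v z = 0"
    if W: "\<And>N. W \<in> closure (G N)" and z: "\<And>y. y \<in> isometric_part v \<Longrightarrow> orthogonal z y" for W z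
  proof -
    have "norm (W *v z) \<le> c ^ N * norm z" for N
    proof -
      have "norm (w *v z) \<le> c ^ N * norm z" if w: "w \<in> G N" for w
      proof -
        have "isometric_part w \<subseteq> isometric_part v"
          using isometric_part_support_cong(2)[of w v] v w by (auto simp: G_def)
        then have "\<forall>y\<in>isometric_part w. orthogonal z y" using z by blast
        then show ?thesis using w by (simp add: G_def)
      qed
      then have "G N \<subseteq> {W. norm (W *v z) \<le> c ^ N * norm z}" by blast
      moreover have "closed {W :: real ^ 'n ^ 'n. norm (W *v z) \<le> c ^ N * norm z}"
        by (intro closed_Collect_le continuous_intros)
      ultimately show ?thesis using W[of N] closure_minimal by blast
    qed
    moreover have "(\<lambda>N. c ^ N * norm z) \<longlonglongrightarrow> 0 * norm z"
      using c by (intro tendsto_intros LIMSEQ_power_zero) auto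
    ultimately have "norm (W *v z) \<le> 0 * norm z"
      by (intro LIMSEQ_le_const) auto
    then show ?thesis by simp
  qed
  have "A *v x = B *v x" for x
  proof -
    obtain y z where y: "y \<in> span (isometric_part v)"
      and z: "\<And>a. a \<in> span (isometric_part v) \<Longrightarrow> orthogonal z a" and x: "x = y + z"
      using orthogonal_subspace_decomp_exists by blast
    have "y \<in> isometric_part v"
      using y subspace_isometric_part[OF v(1)] by (simp add: span_eq_iff[THEN iffD2])
    moreover have "\<And>a. a \<in> isometric_part v \<Longrightarrow> orthogonal z a" using z span_base by blast
    ultimately show ?thesis
      using on_iso[of A y] on_iso[of B y] on_orth[of A z] on_orth[of B z] A B
      by (simp add: x matrix_vector_right_distrib)
  qed
  then show ?thesis by (simp add: matrix_eq)
qed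

section \<open>Factorisation of words into contracting blocks\<close>

text \<open>\<open>u g\<^sub>s \<dots> g\<^sub>1\<close> with \<open>u \<in> C\<close> and each \<open>g\<^sub>i\<close> a generator times an element of \<open>C\<close>; here \<open>C\<close> will be
  the closure of the words with larger isometric part.\<close>

primrec block_products :: "(real ^ 'n ^ 'n) set \<Rightarrow> (real ^ 'n ^ 'n) set \<Rightarrow> nat \<Rightarrow> (real ^ 'n ^ 'n) set" where
  "block_products \<M> C 0 = C"
| "block_products \<M> C (Suc s) = (\<lambda>(w, b, u). w ** (b ** u)) ` (block_products \<M> C s \<times> \<M> \<times> C)"

lemma compact_block_products:
  assumes "finite \<M>" "compact C"
  shows "compact (block_products \<M> C s)"
proof (induction s)
  case (Suc s)
  have "compact (block_products \<M> C s \<times> \<M> \<times> C)"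
    using Suc assms by (simp add: compact_Times finite_imp_compact)
  then show ?case
    by (auto simp: case_prod_unfold intro!: compact_continuous_image continuous_intros)
qed (use assms in simp)

lemma countable_block_products:
  assumes "finite \<M>" "countable C"
  shows "countable (block_products \<M> C s)"
proof (induction s)
  case (Suc s)
  then show ?case
    using assms by (simp add: countable_SIGMA countable_finite)
qed (use assms in simp)

text \<open>Strong induction on length: split off the shortest suffix \<open>g\<close> whose
  isometric part has dimension \<open>d\<close>, then treat the remaining prefix \<open>v\<close>.
  Each block contributes one factor \<open>c\<close>, so the same \<open>s\<close> counts blocks and
  measures contraction.\<close>

lemma word_in_block_products:
  fixes \<M> :: "(real ^ 'n ^ 'n) set"
  assumes ds: "\<M> \<subseteq> doubly_stochastic" and c: "0 \<le> c" "c < 1"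
    and gap: "\<And>xs x. xs \<in> lists \<M> \<Longrightarrow>
      (\<And>z. z \<in> isometric_part (word_product xs) \<Longrightarrow> orthogonal x z) \<Longrightarrow>
      norm (word_product xs *v x) \<le> c * norm x"
    and C: "\<And>xs. xs \<in> lists \<M> \<Longrightarrow> d < dim (isometric_part (word_product xs)) \<Longrightarrow> word_product xs \<in> C"
    and d: "d < CARD('n)"
    and xs: "xs \<in> lists \<M>" "dim (isometric_part (word_product xs)) = d"
  shows "\<exists>s. word_product xs \<in> block_products \<M> C s \<and>
    (\<forall>x. (\<forall>z\<in>isometric_part (word_product xs). orthogonal x z) \<longrightarrow>
      norm (word_product xs *v x) \<le> c ^ s * norm x)"
  using xs
proof (induction "length xs" arbitrary: xs rule: less_induct)
  case less
  obtain ys b zs where split: "xs = ys @ b # zs"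
    and dz: "d < dim (isometric_part (word_product zs))"
    and dbz: "dim (isometric_part (word_product (b # zs))) \<le> d"
    using word_split_at_drop[of xs d] less.prems d by auto
  have mem: "ys \<in> lists \<M>" "b \<in> \<M>" "zs \<in> lists \<M>" using less.prems split by auto
  define v where "v = word_product ys"
  define g where "g = word_product (b # zs)"
  have dsv: "v \<in> doubly_stochastic" and dsg: "g \<in> doubly_stochastic"
    unfolding v_def g_def using mem by (intro word_product_in_doubly_stochastic[OF ds]; simp)+
  have w: "word_product xs = v ** g" by (simp add: split word_product_append v_def g_def)
  have dsw: "v ** g \<in> doubly_stochastic" by (rule doubly_stochastic_mult[OF dsv dsg])
  have sub: "isometric_part (v ** g) \<subseteq> isometric_part g"
    using isometric_part_mult[OF dsv dsg] by auto
  have eq: "isometric_part (v ** g) = isometric_part g"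
    using less.prems(2) dbz w
    by (intro subspace_dim_equal[OF _ _ sub] subspace_isometric_part dsg dsw) (simp add: g_def)
  \<comment> \<open>A vector isometric for the product is still isometric for \<open>v\<close> after
    \<open>g\<close>; hence the isometric part of \<open>v\<close> has dimension at least
    \<open>d\<close>.\<close>
  have gsub: "(*v) g ` isometric_part g \<subseteq> isometric_part v"
    using isometric_part_mult[OF dsv dsg] eq by auto
  have dim_g: "dim ((*v) g ` isometric_part g) = d"
    using dim_image_isometric_part[OF dsg] eq less.prems(2) w by simp
  then have dv: "d \<le> dim (isometric_part v)" using dim_subset[OF gsub] by simp
  have zsC: "word_product zs \<in> C" using C mem dz by blast
  have gx: "norm (g *v x) \<le> c * norm x" if "\<forall>z\<in>isometric_part (v ** g). orthogonal x z" for x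
    unfolding g_def by (rule gap) (use mem that eq in \<open>auto simp: g_def\<close>)
  show ?case
  proof (cases "d < dim (isometric_part v)")
    case True
    \<comment> \<open>\<open>v\<close> lies in \<open>C\<close> and is the leftmost factor;
      \<open>g\<close> is the only block, so \<open>s = 1\<close>.\<close>
    then have "v \<in> block_products \<M> C 0" using C mem by (simp add: v_def)
    then have "v ** g \<in> block_products \<M> C (Suc 0)"
      using zsC mem by (auto simp: g_def intro!: image_eqI[of _ _ "(v, b, word_product zs)"])
    moreover have "norm ((v ** g) *v x) \<le> c ^ Suc 0 * norm x"
      if "\<forall>z\<in>isometric_part (v ** g). orthogonal x z" for x
      using gx[OF that] doubly_stochastic_norm_le[OF dsv, of "g *v x"]
      by (simp add: matrix_vector_mul_assoc[symmetric])
    ultimately show ?thesis unfolding w by blast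
  next
    case False
    then have dv': "dim (isometric_part v) = d" using dv by simp
    then obtain s where s: "v \<in> block_products \<M> C s"
      and bound: "\<And>x. (\<forall>z\<in>isometric_part v. orthogonal x z) \<Longrightarrow> norm (v *v x) \<le> c ^ s * norm x"
      using less.hyps[of ys] mem split by (auto simp: v_def)
    \<comment> \<open>Equal dimensions make \<open>g\<close> map its isometric part onto that of
      \<open>v\<close>. By \<open>inner_isometric_part\<close> it then sends the orthogonal
      complement of the one into that of the other, so the bound for \<open>v\<close> applies after
      \<open>g\<close>.\<close>
    have img: "(*v) g ` isometric_part g = isometric_part v"
      using dim_g dv'
      by (intro subspace_dim_equal[OF _ _ gsub] subspace_isometric_part dsv
          linear_subspace_image dsg) auto
    have "v ** g \<in> block_products \<M> C (Suc s)"
      using s zsC mem by (auto simp: g_def intro!: image_eqI[of _ _ "(v, b, word_product zs)"])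
    moreover have "norm ((v ** g) *v x) \<le> c ^ Suc s * norm x"
      if x: "\<forall>z\<in>isometric_part (v ** g). orthogonal x z" for x
    proof -
      have "\<forall>z\<in>isometric_part v. orthogonal (g *v x) z"
        unfolding img[symmetric] using x eq inner_isometric_part[OF dsg]
        by (auto simp: orthogonal_def)
      then have "norm (v *v (g *v x)) \<le> c ^ s * norm (g *v x)" by (rule bound)
      also have "\<dots> \<le> c ^ s * (c * norm x)" using gx[OF x] c by (intro mult_left_mono) auto
      finally show ?thesis by (simp add: matrix_vector_mul_assoc[symmetric] mult_ac)
    qed
    ultimately show ?thesis unfolding w by blast
  qed
qed

section \<open>Countability of the closure\<close>

lemma countable_closure_semigroup_aux:
  fixes \<M> :: "(real ^ 'n ^ 'n) set"
  assumes fin: "finite \<M>" and ds: "\<M> \<subseteq> doubly_stochastic"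
  shows "countable (closure {word_product xs | xs. xs \<in> lists \<M> \<and>
    CARD('n) < dim (isometric_part (word_product xs)) + k})"
proof (induction k)
  case 0
  have "\<not> CARD('n) < dim (isometric_part (word_product xs))" for xs :: "(real ^ 'n ^ 'n) list"
    using dim_subset_UNIV_cart[of "isometric_part (word_product xs)"] by simp
  then show ?case by simp
next
  case (Suc k)
  define S where "S k = {word_product xs | xs. xs \<in> lists \<M> \<and>
    CARD('n) < dim (isometric_part (word_product xs)) + k}" for k
  \<comment> \<open>The closure of the words of smaller codimension is countable by the induction
    hypothesis and supplies the factors of the blocks.\<close>
  define C where "C = closure (S k)"
  have countC: "countable C" using Suc by (simp add: C_def S_def)
  have "S k \<subseteq> doubly_stochastic"
    using word_product_in_doubly_stochastic[OF ds] by (auto simp: S_def)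
  then have compC: "compact C"
    unfolding C_def compact_closure using bounded_doubly_stochastic bounded_subset by blast
  obtain c where c: "0 \<le> c" "c < 1"
    and gap: "\<And>xs x. xs \<in> lists \<M> \<Longrightarrow>
      (\<And>z. z \<in> isometric_part (word_product xs) \<Longrightarrow> orthogonal x z) \<Longrightarrow>
      norm (word_product xs *v x) \<le> c * norm x"
    using semigroup_gap[OF fin ds] by blast
  define F where "F = block_products \<M> C"
  define G where "G \<sigma> N = {w \<in> doubly_stochastic. matrix_support w = \<sigma> \<and>
    (\<forall>x. (\<forall>z\<in>isometric_part w. orthogonal x z) \<longrightarrow> norm (w *v x) \<le> c ^ N * norm x)}"
    for \<sigma> :: "('n \<times> 'n) set" and N
  have pow: "c ^ s \<le> c ^ N" if "N \<le> s" for s N using c that by (simp add: power_decreasing)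
  have G_mono: "G \<sigma> s \<subseteq> G \<sigma> N" if "N \<le> s" for \<sigma> s N
  proof -
    have "c ^ s * norm x \<le> c ^ N * norm x" for x :: "real ^ 'n"
      by (rule mult_right_mono[OF pow[OF that]]) simp
    then show ?thesis unfolding G_def by (blast intro: order_trans)
  qed
  \<comment> \<open>For every cut-off \<open>N\<close>, a word has smaller codimension, or at most
    \<open>N\<close> blocks, or is contracted by \<open>c ^ N\<close>.\<close>
  have cover: "S (Suc k) \<subseteq> C \<union> (\<Union>s\<le>N. F s) \<union> (\<Union>\<sigma>. G \<sigma> N)" for N
  proof
    fix w assume "w \<in> S (Suc k)"
    then obtain xs where w: "w = word_product xs" and xs: "xs \<in> lists \<M>"
      and dim: "CARD('n) < dim (isometric_part w) + Suc k" by (auto simp: S_def)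
    have dsw: "w \<in> doubly_stochastic" using w word_product_in_doubly_stochastic[OF ds xs] by simp
    consider "CARD('n) < dim (isometric_part w) + k" | "CARD('n) = dim (isometric_part w)"
      | "CARD('n) = dim (isometric_part w) + k" "k > 0" using dim by linarith
    then show "w \<in> C \<union> (\<Union>s\<le>N. F s) \<union> (\<Union>\<sigma>. G \<sigma> N)"
    proof cases
      case 1
      then have "w \<in> S k" using w xs by (auto simp: S_def)
      then show ?thesis using closure_subset by (auto simp: C_def)
    next
      case 2
      \<comment> \<open>The orthogonal complement is trivial, so the contraction bound holds for
        every \<open>N\<close>.\<close>
      then have "span (isometric_part w) = UNIV"
        by (metis dim_eq_full DIM_cart DIM_real mult.right_neutral)
      then have "isometric_part w = UNIV"
        using subspace_isometric_part[OF dsw] by (simp add: span_eq_iff[THEN iffD2])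
      then have "x = 0" if "\<forall>z\<in>isometric_part w. orthogonal x z" for x
        using that orthogonal_self by blast
      then have "norm (w *v x) \<le> c ^ N * norm x" if "\<forall>z\<in>isometric_part w. orthogonal x z" for x
        using that by fastforce
      then have "w \<in> G (matrix_support w) N" using dsw by (simp add: G_def)
      then show ?thesis by blast
    next
      case 3
      have "\<exists>s. word_product xs \<in> block_products \<M> C s \<and>
        (\<forall>x. (\<forall>z\<in>isometric_part (word_product xs). orthogonal x z) \<longrightarrow>
          norm (word_product xs *v x) \<le> c ^ s * norm x)"
      proof (rule word_in_block_products[OF ds c gap])
        fix ys assume "ys \<in> lists \<M>" "dim (isometric_part w) < dim (isometric_part (word_product ys))"
        then have "word_product ys \<in> S k" using 3 by (auto simp: S_def)
        then show "word_product ys \<in> C" using closure_subset by (auto simp: C_def)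
      qed (use 3 w xs in auto)
      then obtain s where s: "w \<in> F s" "w \<in> G (matrix_support w) s"
        using w dsw by (auto simp: F_def G_def)
      then show ?thesis using G_mono[of N s "matrix_support w"] by (cases "s \<le> N") auto
    qed
  qed
  \<comment> \<open>A limit outside the last union escapes \<open>closure (G \<sigma> N)\<close> for
    some \<open>N\<close> depending on \<open>\<sigma>\<close>. Supports are finite in number, so
    one \<open>m\<close> works for all of them; with each \<open>G \<sigma> m\<close> replaced by
    its closure, the cover for \<open>m\<close> is a finite union of closed sets and contains the
    limit.\<close>
  have "closure (S (Suc k)) \<subseteq> C \<union> (\<Union>s. F s) \<union> (\<Union>\<sigma>. \<Inter>N. closure (G \<sigma> N))"
  proof
    fix A assume A: "A \<in> closure (S (Suc k))"
    show "A \<in> C \<union> (\<Union>s. F s) \<union> (\<Union>\<sigma>. \<Inter>N. closure (G \<sigma> N))"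
    proof (rule ccontr)
      assume not: "\<not> ?thesis"
      then have "\<forall>\<sigma>. \<exists>N. A \<notin> closure (G \<sigma> N)" by blast
      then obtain N where N: "\<And>\<sigma>. A \<notin> closure (G \<sigma> (N \<sigma>))" by metis
      define m where "m = Max (range N)"
      have "N \<sigma> \<le> m" for \<sigma> unfolding m_def by simp
      then have out: "A \<notin> closure (G \<sigma> m)" for \<sigma>
        using N[of \<sigma>] closure_mono[OF G_mono[of "N \<sigma>" m \<sigma>]] by blast
      have "closed (C \<union> (\<Union>s\<le>m. F s) \<union> (\<Union>\<sigma>. closure (G \<sigma> m)))"
        using compC compact_block_products[OF fin compC]
        by (intro closed_Un closed_UN) (auto simp: F_def compact_imp_closed)
      moreover have "S (Suc k) \<subseteq> C \<union> (\<Union>s\<le>m. F s) \<union> (\<Union>\<sigma>. closure (G \<sigma> m))"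
        by (rule order_trans[OF cover[of m]]) (intro Un_mono UN_mono closure_subset order_refl)
      ultimately have "A \<in> C \<union> (\<Union>s\<le>m. F s) \<union> (\<Union>\<sigma>. closure (G \<sigma> m))"
        using A closure_minimal by blast
      then show False using not out by blast
    qed
  qed
  moreover have "countable (\<Inter>N. closure (G \<sigma> N))" for \<sigma>
  proof -
    have "A = B" if "A \<in> (\<Inter>N. closure (G \<sigma> N))" "B \<in> (\<Inter>N. closure (G \<sigma> N))" for A B
      by (rule contracted_words_limit_unique[OF c, of _ \<sigma>]) (use that in \<open>auto simp: G_def\<close>)
    then have "is_singleton (\<Inter>N. closure (G \<sigma> N)) \<or> (\<Inter>N. closure (G \<sigma> N)) = {}"
      by (metis is_singletonI')
    then show ?thesis by (auto simp: is_singleton_def)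
  qed
  ultimately have "countable (closure (S (Suc k)))"
    using countC countable_block_products[OF fin countC]
    by (elim countable_subset) (auto simp: F_def intro!: countable_UN countable_finite)
  then show ?case by (simp add: S_def)
qed

section \<open>From countability to nowhere density\<close>

theorem countable_closure_semigroup:
  fixes \<M> :: "(real ^ 'n ^ 'n) set"
  assumes "finite \<M>" "\<M> \<subseteq> doubly_stochastic"
  shows "countable (closure (matrix_semigroup \<M>))"
proof -
  have eq: "matrix_semigroup \<M> = {word_product xs | xs. xs \<in> lists \<M> \<and>
      CARD('n) < dim (isometric_part (word_product xs)) + Suc CARD('n)}"
    by (auto simp: matrix_semigroup_eq_word_products)
  show ?thesis unfolding eq by (rule countable_closure_semigroup_aux[OF assms])
qed

theorem theorem5p12:
  fixes p q :: "real ^ 'n" and \<M> :: "(real ^ 'n ^ 'n) set"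
  assumes "p \<in> std_simplex" and "q \<in> std_simplex"
    and "finite \<M>" and "\<M> \<subseteq> doubly_stochastic"
  shows "nowhere_dense {q \<bullet> (M *v p) | M. M \<in> matrix_semigroup \<M>}"
proof -
  let ?f = "\<lambda>M. q \<bullet> (M *v p)" and ?K = "closure (matrix_semigroup \<M>)"
  have "matrix_semigroup \<M> \<subseteq> doubly_stochastic"
    unfolding matrix_semigroup_eq_word_products
    using word_product_in_doubly_stochastic[OF assms(4)] by blast
  then have "compact ?K"
    unfolding compact_closure using bounded_doubly_stochastic bounded_subset by blast
  \<comment> \<open>Being closed, the image also contains the closure of the set of values.\<close>
  then have "closed (?f ` ?K)"
    by (intro compact_imp_closed compact_continuous_image continuous_intros)
  moreover have "{?f M | M. M \<in> matrix_semigroup \<M>} \<subseteq> ?f ` ?K" using closure_subset by blast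
  ultimately have "interior (closure {?f M | M. M \<in> matrix_semigroup \<M>}) \<subseteq> ?f ` ?K"
    using closure_minimal interior_subset by (metis (no_types, lifting) order_trans)
  moreover have "countable (?f ` ?K)" using countable_closure_semigroup[OF assms(3,4)] by simp
  ultimately have "countable (interior (closure {?f M | M. M \<in> matrix_semigroup \<M>}))"
    by (rule countable_subset)
  \<comment> \<open>A nonempty open set of reals is uncountable.\<close>
  then show ?thesis
    unfolding nowhere_dense_def using open_minus_countable open_interior by blast
qed

end
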